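(* The fourth Birkhoff polytope $B_4$ has a non-regular triangulation.
   Context: The $p$th Birkhoff polytope $B_p$ is the set of $p\times p$ real matrices with non-negative entries whose rows and columns all sum to $1$; its vertices are the $p!$ permutation matrices. A triangulation of a finite point set $A$ in convex position is a simplicial complex of simplices with vertices in $A$ whose union is $\mathrm{conv}(A)$ and in which any two simplices intersect in a common face; a triangulation of a polytope means a triangulation of its vertex set. A triangulation is regular if it is the projection of the lower envelope (the facets visible from below) of $\mathrm{conv}\{(a,w(a)) : a\in A\}$ for some lifting function $w:A\to\mathbb{R}$. *)

theory Defs
  imports "HOL-Analysis.Analysis"
begin

(* The matrices are indexed by a finite type 'p, so that B_p is the case CARD('p) = p. *)
definition birkhoff_polytope :: "(real ^ 'p ^ 'p) set" where
  "birkhoff_polytope =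
     {M. (\<forall>i j. 0 \<le> M $ i $ j) \<and> (\<forall>i. (\<Sum>j\<in>UNIV. M $ i $ j) = 1) \<and>
         (\<forall>j. (\<Sum>i\<in>UNIV. M $ i $ j) = 1)}"

definition vertices :: "'a::real_vector set \<Rightarrow> 'a set" where
  "vertices P = {v. v extreme_point_of P}"

definition convex_position :: "'a::real_vector set \<Rightarrow> bool" where
  "convex_position A \<longleftrightarrow> (\<forall>a\<in>A. a extreme_point_of (convex hull A))"

(* A simplicial complex is a set of simplices closed under taking faces; like the library's
   simplicial_complex, it contains the empty simplex unless it is empty itself. *)
definition triangulation_of :: "'a::euclidean_space set \<Rightarrow> 'a set set \<Rightarrow> bool" where
  "triangulation_of A \<T> \<longleftrightarrow>
     finite A \<and> convex_position A \<and>
     simplicial_complex \<T> \<and> (\<forall>S\<in>\<T>. vertices S \<subseteq> A) \<and> \<Union>\<T> = convex hull A"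

definition lifted_polytope :: "('a::real_vector \<Rightarrow> real) \<Rightarrow> 'a set \<Rightarrow> ('a \<times> real) set" where
  "lifted_polytope w A = convex hull ((\<lambda>a. (a, w a)) ` A)"

definition lower_envelope :: "('a \<times> real) set \<Rightarrow> ('a \<times> real) set" where
  "lower_envelope P = {(x, t). (x, t) \<in> P \<and> (\<forall>s<t. (x, s) \<notin> P)}"

(* All faces inside the lower envelope are projected, that is, the facets visible from below
   together with all their faces. This makes the result a complex, comparable with a
   simplicial_complex, and is also correct when w is affine on A: then the lifted
   polytope has the dimension of A, is its own lower envelope, and projects to conv A. *)
definition lower_projection :: "('a::real_vector \<Rightarrow> real) \<Rightarrow> 'a set \<Rightarrow> 'a set set" where
  "lower_projection w A =
     {fst ` F |F. F face_of lifted_polytope w A \<and> F \<subseteq> lower_envelope (lifted_polytope w A)}"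

definition regular_triangulation_of :: "'a::euclidean_space set \<Rightarrow> 'a set set \<Rightarrow> bool" where
  "regular_triangulation_of A \<T> \<longleftrightarrow>
     triangulation_of A \<T> \<and> (\<exists>w. \<T> = lower_projection w A)"

end

theory Submission
  imports Defs
begin

text \<open>
  There are eleven vertices of \<open>B\<^sub>4\<close> that span a polytope of dimension seven and carry a triangulation with
  fourteen maximal cells containing, for each of three circuits, the simplex on its negative part. A lifting
  function that induces this triangulation is strictly larger on the positive part of each of these circuits than
  on the negative part; since the three circuits add up to zero, no such function exists. Placing the
  remaining vertices of \<open>B\<^sub>4\<close> one after the other extends the triangulation to \<open>B\<^sub>4\<close> and keeps
  its cells, hence the obstruction.
\<close>

subsection \<open>Extending a triangulation by placing a point\<close>

text \<open>The eleven points are handled in the Gale dual. Their relations form a three-dimensional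
  space with coordinates \<open>(a, b, c)\<close>, so a cell with eight vertices is recorded by the
  three labels that it omits. In the dual, \<open>E1\<close>, \<open>E2\<close>, \<open>E3\<close>
  are the unit vectors, \<open>N1\<close>, \<open>N2\<close>, \<open>N3\<close> their negatives, and
  each \<open>D\<close> is a negated sum of two unit vectors. Cells fit together when the open cones
  over their omitted labels meet pairwise, whereas a lifting function would provide a single point
  common to all these cones. The cones over \<open>D3, N3, E1\<close>, over
  \<open>D1, N1, E2\<close> and over \<open>D2, N2, E3\<close> lie in the half-spaces
  \<open>x > y\<close>, \<open>y > z\<close> and \<open>z > x\<close>: they meet in pairs, but not
  all together. The three circuits are these half-spaces, and all checks on cells reduce to linear
  arithmetic in three unknowns.\<close>

definition visible :: "'a::real_vector set \<Rightarrow> 'a \<Rightarrow> 'a set" where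
  "visible P v = {x \<in> P. \<forall>s. 0 < s \<and> s \<le> 1 \<longrightarrow> (1 - s) *\<^sub>R x + s *\<^sub>R v \<notin> P}"

lemma visible_subset: "visible P v \<subseteq> P"
  by (auto simp: visible_def)

text \<open>Compactness gives a last point of \<open>P\<close> on the segment from \<open>y\<close>
  to \<open>v\<close>. It is visible, and convexity puts \<open>p\<close> strictly beyond
  it.\<close>

lemma visible_last_point:
  fixes P :: "'a::euclidean_space set"
  assumes "compact P" "convex P" "y \<in> P" "0 \<le> r" "r \<le> 1"
    and p: "p = (1 - r) *\<^sub>R y + r *\<^sub>R v" "p \<notin> P"
  obtains x s where "x \<in> visible P v" "0 < s" "s \<le> 1" "p = (1 - s) *\<^sub>R x + s *\<^sub>R v"
proof -
  let ?\<gamma> = "\<lambda>t. (1 - t) *\<^sub>R y + t *\<^sub>R v"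
  define I where "I = {0..1::real} \<inter> ?\<gamma> -` P"
  have "continuous_on {0..1} ?\<gamma>"
    by (intro continuous_intros)
  then have "closed I"
    unfolding I_def using assms(1) by (intro continuous_closed_preimage) (auto intro: compact_imp_closed)
  then have "compact I"
    using bounded_subset[OF bounded_closed_interval, of I 0 1] by (auto simp: compact_eq_bounded_closed I_def)
  moreover have "0 \<in> I"
    using \<open>y \<in> P\<close> by (simp add: I_def)
  ultimately obtain t where t: "t \<in> I" "\<And>u. u \<in> I \<Longrightarrow> u \<le> t"
    using compact_attains_sup[of I] by fastforce
  have "?\<gamma> t \<in> P" "0 \<le> t" "t \<le> 1" using t(1) by (auto simp: I_def)
  have "t < r"
  proof (rule ccontr)
    assume "\<not> t < r"
    then have "r \<le> t" "0 \<le> t" using assms by auto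
    show False
    proof (cases "t = 0")
      case True
      then show False using \<open>r \<le> t\<close> assms by auto
    next
      case False
      have "(1 - r/t) *\<^sub>R y + (r/t) *\<^sub>R ?\<gamma> t \<in> P"
        using convexD[OF \<open>convex P\<close> \<open>y \<in> P\<close> \<open>?\<gamma> t \<in> P\<close>, of "1 - r/t" "r/t"] \<open>r \<le> t\<close> \<open>0 \<le> r\<close> False \<open>0 \<le> t\<close>
        by simp
      also have "(1 - r/t) *\<^sub>R y + (r/t) *\<^sub>R ?\<gamma> t = (1 - r/t + (r/t) * (1 - t)) *\<^sub>R y + (r/t*t) *\<^sub>R v"
        by (simp add: scaleR_right_distrib scaleR_left_distrib)
      also have "\<dots> = p"
      proof -
        have "1 - r/t + (r/t) * (1 - t) = 1 - r" "r/t*t = r"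
          using False by (simp_all add: field_simps)
        then show ?thesis by (simp add: p)
      qed
      finally show False using p by simp
    qed
  qed
  \<comment> \<open>The position of \<open>p\<close> on the remaining segment:
    \<open>t + s * (1 - t) = r\<close>.\<close>
  define s where "s = (r - t) / (1 - t)"
  have t1: "1 - t > 0" using \<open>t < r\<close> assms by linarith
  have scale: "(1 - u) *\<^sub>R ?\<gamma> t + u *\<^sub>R v = ?\<gamma> (t + u * (1 - t))" for u
    by (simp add: algebra_simps)
  have "?\<gamma> t \<in> visible P v"
    unfolding visible_def
  proof (intro CollectI conjI allI impI, fact \<open>?\<gamma> t \<in> P\<close>, elim conjE, rule notI)
    fix u :: real assume u: "0 < u" "u \<le> 1" and "(1 - u) *\<^sub>R ?\<gamma> t + u *\<^sub>R v \<in> P"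
    moreover have "u * (1 - t) \<le> 1 * (1 - t)" "0 < u * (1 - t)"
      using u t1 by (simp_all add: mult_right_mono)
    ultimately have "t + u * (1 - t) \<in> I"
      using \<open>0 \<le> t\<close> unfolding scale I_def by auto
    with t(2) \<open>0 < u * (1 - t)\<close> show False by force
  qed
  moreover have "0 < s" "s \<le> 1" using \<open>t < r\<close> t1 \<open>r \<le> 1\<close> by (auto simp: s_def)
  moreover have "p = (1 - s) *\<^sub>R ?\<gamma> t + s *\<^sub>R v"
    unfolding scale p using t1 by (simp add: s_def)
  ultimately show ?thesis using that by blast
qed

text \<open>If \<open>s' < s\<close>, solving the equation for \<open>x'\<close> puts this point of
  \<open>P\<close> on the segment from \<open>x\<close> to \<open>v\<close>, away from
  \<open>x\<close>, so \<open>x\<close> would not be visible. The bounds by 1 exclude the apex,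
  which all rays share.\<close>

lemma visible_ray_unique:
  assumes x: "x \<in> visible P v" and x': "x' \<in> visible P v" and s: "s < 1" "s' < 1"
    and eq: "(1 - s) *\<^sub>R x + s *\<^sub>R v = (1 - s') *\<^sub>R x' + s' *\<^sub>R v"
  shows "x = x'"
proof -
  have *: False if x: "x \<in> visible P v" and x': "x' \<in> P" and s: "s' < s" "s < 1"
    and eq: "(1 - s) *\<^sub>R x + s *\<^sub>R v = (1 - s') *\<^sub>R x' + s' *\<^sub>R v" for x x' s s'
  proof -
    have nz: "1 - s' > 0" using s by simp
    have "(1 - s') *\<^sub>R x' = (1 - s) *\<^sub>R x + (s - s') *\<^sub>R v"
      using eq by (simp add: algebra_simps)
    then have "x' = (1 / (1 - s')) *\<^sub>R ((1 - s) *\<^sub>R x + (s - s') *\<^sub>R v)"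
      using nz by (metis less_irrefl scaleR_one scaleR_scaleR nonzero_eq_divide_eq)
    also have "\<dots> = ((1 - s) / (1 - s')) *\<^sub>R x + ((s - s') / (1 - s')) *\<^sub>R v"
      by (simp add: scaleR_right_distrib)
    also have "(1 - s) / (1 - s') = 1 - (s - s') / (1 - s')"
      using nz by (simp add: field_simps)
    finally have "x' = (1 - (s - s') / (1 - s')) *\<^sub>R x + ((s - s') / (1 - s')) *\<^sub>R v" .
    moreover have "0 < (s - s') / (1 - s')" "(s - s') / (1 - s') \<le> 1"
      using s nz by auto
    ultimately show False using x x' by (auto simp: visible_def)
  qed
  have "s = s'"
    using *[OF x _ _ s(1) eq] *[OF x' _ _ s(2) eq[symmetric]] visible_subset x x'
    by (meson linorder_neqE_linordered_idom subsetD)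
  then show ?thesis using eq s by simp
qed

text \<open>Suppose some \<open>y'\<close> in \<open>P\<close> lies beyond \<open>y\<close> towards
  \<open>v\<close>. Prolong the segment from \<open>y\<close> through \<open>x\<close> to a point
  \<open>z\<close> of \<open>F\<close>. The segment from \<open>y'\<close> to \<open>z\<close> stays
  in \<open>P\<close> and crosses the one from \<open>x\<close> to \<open>v\<close> away from
  \<open>x\<close>.\<close>

lemma rel_interior_visible_subset:
  fixes F :: "'a::euclidean_space set"
  assumes "convex P" "convex F" "F \<subseteq> P" and x: "x \<in> rel_interior F" "x \<in> visible P v"
  shows "F \<subseteq> visible P v"
proof
  fix y assume "y \<in> F"
  have "F \<noteq> {}" using \<open>y \<in> F\<close> by auto
  then obtain e where e: "e > 1" and z: "(1 - e) *\<^sub>R y + e *\<^sub>R x \<in> F" (is "?z \<in> F")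
    using convex_rel_interior_iff[OF \<open>convex F\<close>] x \<open>y \<in> F\<close> by blast
  show "y \<in> visible P v"
    unfolding visible_def
  proof (intro CollectI conjI allI impI, use \<open>y \<in> F\<close> \<open>F \<subseteq> P\<close> in blast, elim conjE, rule notI)
    fix s :: real assume s: "0 < s" "s \<le> 1" and y': "(1 - s) *\<^sub>R y + s *\<^sub>R v \<in> P" (is "?y' \<in> P")
    \<comment> \<open>\<open>\<epsilon>\<close> is the weight of \<open>y\<close> when
      \<open>x\<close> is written as a combination of \<open>y\<close> and \<open>z\<close>. The
      weight \<open>a\<close> makes the coefficients of \<open>y\<close> and \<open>z\<close> in
      \<open>a y' + (1 - a) z\<close> proportional to \<open>\<epsilon>\<close> and
      \<open>1 - \<epsilon>\<close>, which gives the crossing point.\<close>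
    define \<epsilon> where "\<epsilon> = 1 - 1 / e"
    have \<epsilon>: "0 < \<epsilon>" "\<epsilon> < 1" using e by (auto simp: \<epsilon>_def)
    define a where "a = \<epsilon> / (1 - s + s * \<epsilon>)"
    have den: "1 - s + s * \<epsilon> > 0" using s \<epsilon> by (simp add: add_nonneg_pos)
    have le: "\<epsilon> \<le> 1 - s + s * \<epsilon>"
    proof -
      have "(1 - s) * \<epsilon> \<le> (1 - s) * 1" using s \<epsilon> by (intro mult_left_mono) auto
      then show ?thesis by (simp add: algebra_simps)
    qed
    have a: "0 < a" "a \<le> 1" using den le \<epsilon> by (auto simp: a_def)
    have "a * (1 - s + s * \<epsilon>) = \<epsilon>" using den by (simp add: a_def)
    then have a_eq: "a * (1 - s) = (1 - a * s) * \<epsilon>" by (simp add: algebra_simps)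
    then have b_eq: "1 - a = (1 - a * s) * (1 - \<epsilon>)" by (simp add: algebra_simps)
    have "?z \<in> P" using z \<open>F \<subseteq> P\<close> by blast
    then have "a *\<^sub>R ?y' + (1 - a) *\<^sub>R ?z \<in> P"
      using convexD[OF \<open>convex P\<close> y' \<open>?z \<in> P\<close>, of a "1 - a"] a by simp
    also have "a *\<^sub>R ?y' + (1 - a) *\<^sub>R ?z = (a * (1 - s)) *\<^sub>R y + (a * s) *\<^sub>R v + (1 - a) *\<^sub>R ?z"
      by (simp add: scaleR_right_distrib)
    also have "\<dots> = (1 - a * s) *\<^sub>R (\<epsilon> *\<^sub>R y + (1 - \<epsilon>) *\<^sub>R ?z) + (a * s) *\<^sub>R v"
      unfolding a_eq b_eq by (simp add: scaleR_right_distrib mult.assoc)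
    also have "\<epsilon> *\<^sub>R y + (1 - \<epsilon>) *\<^sub>R ?z = (\<epsilon> + (1 - \<epsilon>) * (1 - e)) *\<^sub>R y + ((1 - \<epsilon>) * e) *\<^sub>R x"
      by (simp add: scaleR_right_distrib scaleR_left_distrib)
    also have "\<epsilon> + (1 - \<epsilon>) * (1 - e) = 0"
      using e by (simp add: \<epsilon>_def field_simps)
    also have "(1 - \<epsilon>) * e = 1"
      using e by (simp add: \<epsilon>_def field_simps)
    finally have "(1 - a * s) *\<^sub>R x + (a * s) *\<^sub>R v \<in> P" by simp
    moreover have "0 < a * s" "a * s \<le> 1" using a s by (auto simp: mult_le_one)
    ultimately show False using x(2) by (auto simp: visible_def)
  qed
qed

text \<open>Otherwise a short step from a relative interior point towards \<open>v\<close> would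
  stay in \<open>F\<close>. Consequently the cone with apex \<open>v\<close> over a visible simplex
  is again a simplex.\<close>

lemma visible_notin_affine_hull:
  fixes F :: "'a::euclidean_space set"
  assumes "convex F" "F \<subseteq> visible P v"
  shows "v \<notin> affine hull F"
proof
  assume v: "v \<in> affine hull F"
  then have "F \<noteq> {}" by auto
  then obtain x where x: "x \<in> rel_interior F"
    using assms(1) rel_interior_eq_empty by blast
  then obtain e where "e > 0" and e: "ball x e \<inter> affine hull F \<subseteq> F" and "x \<in> F"
    by (auto simp: mem_rel_interior_ball)
  let ?n = "norm (v - x)"
  define s where "s = min 1 (e / (?n + 1))"
  have n1: "?n + 1 > 0" by (simp add: add_nonneg_pos)
  have s: "0 < s" "s \<le> 1" "s \<le> e / (?n + 1)" using \<open>e > 0\<close> n1 by (auto simp: s_def)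
  let ?p = "(1 - s) *\<^sub>R x + s *\<^sub>R v"
  have "s * (?n + 1) \<le> e" using s(3) n1 by (simp add: pos_le_divide_eq)
  then have "s * ?n < e" using s(1) by (simp add: distrib_left)
  moreover have "dist x ?p = s * norm (v - x)"
  proof -
    have "?p - x = s *\<^sub>R (v - x)" by (simp add: algebra_simps)
    then show ?thesis using s by (metis abs_of_pos dist_commute dist_norm norm_scaleR)
  qed
  ultimately have "dist x ?p < e"
    by simp
  moreover have "?p \<in> affine hull F"
    using mem_affine[OF affine_affine_hull hull_inc[OF \<open>x \<in> F\<close>] v, of "1 - s" s] by simp
  ultimately have "?p \<in> F" using e by auto
  then show False using assms(2) s \<open>x \<in> F\<close> unfolding visible_def by blast
qed

lemma convex_hull_insert_convex:
  assumes "convex F" "x \<in> convex hull (insert v F)" "F \<noteq> {}"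
  obtains y r where "y \<in> F" "0 \<le> r" "r \<le> 1" "x = (1 - r) *\<^sub>R y + r *\<^sub>R v"
proof -
  obtain y where "y \<in> F" "x \<in> closed_segment v y"
    using assms(2,3) hull_same[of convex F, OF assms(1)] by (auto simp: convex_hull_insert_segments)
  then have "x \<in> closed_segment y v" by (simp add: closed_segment_commute)
  then show ?thesis using that \<open>y \<in> F\<close> by (auto simp: in_segment)
qed

text \<open>Take a minimal simplex containing \<open>x\<close>: were \<open>x\<close> on its
  relative boundary, a proper face, also in the complex, would contain it.\<close>

lemma simplicial_complex_rel_interior:
  assumes "simplicial_complex \<T>" "x \<in> \<Union>\<T>"
  obtains F where "F \<in> \<T>" "x \<in> rel_interior F"
proof -
  let ?\<A> = "{S \<in> \<T>. x \<in> S}"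
  have "finite ?\<A>" "?\<A> \<noteq> {}"
    using assms by (auto simp: simplicial_complex_def)
  then obtain F where F: "F \<in> ?\<A>" "\<And>G. G \<in> ?\<A> \<Longrightarrow> G \<subseteq> F \<Longrightarrow> F = G"
    using finite_has_minimal[of ?\<A>] by metis
  have "x \<in> rel_interior F"
  proof (rule ccontr)
    assume nin: "x \<notin> rel_interior F"
    obtain n where n: "n simplex F" using F(1) assms(1) by (auto simp: simplicial_complex_def)
    then have "polyhedron F" "closed F"
      by (auto simp: simplex_imp_polyhedron closed_simplex)
    then have "x \<in> rel_frontier F"
      using F(1) nin by (simp add: rel_frontier_def)
    then obtain G where G: "G face_of F" "G \<noteq> F" "x \<in> G"
      using rel_frontier_of_polyhedron_alt[OF \<open>polyhedron F\<close>] by blast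
    then have "G \<in> ?\<A>" using F(1) assms(1) by (auto simp: simplicial_complex_def)
    then show False using F(2)[of G] G face_of_imp_subset by blast
  qed
  then show ?thesis using that F(1) by blast
qed

lemma face_of_insert_simplex:
  assumes "n simplex F" "v \<notin> affine hull F"
  shows "G face_of convex hull (insert v F) \<longleftrightarrow>
    G face_of F \<or> (\<exists>F'. F' face_of F \<and> G = convex hull (insert v F'))"
proof -
  obtain C where C: "finite C" "F = convex hull C"
    using assms(1) by (auto simp: simplex)
  have "convex hull (insert v F) = convex hull (insert v C)"
    unfolding C(2) by (rule hull_insert[symmetric])
  then show ?thesis
    using face_of_convex_hull_insert_eq[OF C(1)] assms(2) C(2) by simp
qed

text \<open>The placing step: add the cones with apex \<open>v\<close> over the faces visible from \<open>v\<close>. A ray from \<open>v\<close>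
  has at most one visible point, so two such cones can only meet in the cone over a common face.\<close>

theorem placing_extension:
  fixes v :: "'a::euclidean_space"
  assumes cpx: "simplicial_complex \<T>" and cov: "\<Union>\<T> = convex hull A" and "finite A" "A \<noteq> {}"
    and vert: "\<And>S. S \<in> \<T> \<Longrightarrow> vertices S \<subseteq> A" and v: "v \<notin> convex hull A"
  obtains \<T>' where "\<T> \<subseteq> \<T>'" "simplicial_complex \<T>'" "\<Union>\<T>' = convex hull (insert v A)"
    "\<And>S. S \<in> \<T>' \<Longrightarrow> vertices S \<subseteq> insert v A"
proof -
  let ?P = "convex hull A"
  let ?V = "visible ?P v"
  \<comment> \<open>The empty simplex belongs to \<open>\<V>\<close>; its cone is
    \<open>{v}\<close>, so the new vertex enters the complex this way.\<close>
  define \<V> where "\<V> = {F \<in> \<T>. F \<subseteq> ?V}"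
  define cone where "cone F = convex hull (insert v F)" for F
  have fin: "finite \<T>" and simp: "\<And>S. S \<in> \<T> \<Longrightarrow> \<exists>n. n simplex S"
    and face: "\<And>F S. S \<in> \<T> \<Longrightarrow> F face_of S \<Longrightarrow> F \<in> \<T>"
    and int: "\<And>S S'. S \<in> \<T> \<Longrightarrow> S' \<in> \<T> \<Longrightarrow> S \<inter> S' face_of S"
    using cpx by (auto simp: simplicial_complex_def)
  have conv: "convex S" if "S \<in> \<T>" for S
    using simp[OF that] convex_simplex by blast
  have \<V>face: "F \<in> \<V>" if "S \<in> \<V>" "F face_of S" for F S
    using that face face_of_imp_subset by (fastforce simp: \<V>_def)
  have \<V>int: "F \<inter> G \<in> \<V>" if "F \<in> \<V>" "G \<in> \<V>" for F G
    using that int[of F G] \<V>face[of F "F \<inter> G"] by (auto simp: \<V>_def)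
  have aff: "v \<notin> affine hull F" if "F \<in> \<V>" for F
    using that conv visible_notin_affine_hull by (auto simp: \<V>_def)
  have cone_face: "G face_of cone F \<longleftrightarrow> G face_of F \<or> (\<exists>F'. F' face_of F \<and> G = cone F')"
    if "F \<in> \<V>" for F G
    using simp[of F] face_of_insert_simplex[OF _ aff[OF that]] that by (auto simp: \<V>_def cone_def)
  have coneE: "x = v \<or> (\<exists>y r. y \<in> F \<and> 0 \<le> r \<and> r < 1 \<and> x = (1 - r) *\<^sub>R y + r *\<^sub>R v)"
    if x: "x \<in> cone F" and "F \<in> \<V>" for x F
  proof (cases "F = {}")
    case True then show ?thesis using that by (simp add: cone_def)
  next
    case False
    have "convex F" using that conv by (simp add: \<V>_def)
    obtain y r where "y \<in> F" "0 \<le> r" "r \<le> 1" "x = (1 - r) *\<^sub>R y + r *\<^sub>R v"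
      by (rule convex_hull_insert_convex[OF \<open>convex F\<close> x[unfolded cone_def] False])
    then show ?thesis
    proof (cases "r = 1")
      case False
      then have "r < 1" using \<open>r \<le> 1\<close> by simp
      then show ?thesis using \<open>y \<in> F\<close> \<open>0 \<le> r\<close> \<open>x = _\<close> by blast
    qed simp
  qed
  have sub_cone: "F \<subseteq> cone F" "v \<in> cone F" for F
    using hull_subset[of "insert v F" convex] by (simp_all add: cone_def)
  \<comment> \<open>A point of the cone off its base lies beyond a visible point, hence outside the
    old polytope.\<close>
  have inT: "S \<inter> cone F = S \<inter> F" if "S \<in> \<T>" "F \<in> \<V>" for S F
  proof -
    have "x \<in> F" if x: "x \<in> S" "x \<in> cone F" for x
    proof -
      have "x \<in> ?P" using x \<open>S \<in> \<T>\<close> cov by blast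
      then obtain y r where y: "y \<in> F" "0 \<le> r" "r < 1" "x = (1 - r) *\<^sub>R y + r *\<^sub>R v"
        using coneE[OF x(2) \<open>F \<in> \<V>\<close>] v by metis
      have "y \<in> ?V" using y(1) \<open>F \<in> \<V>\<close> by (auto simp: \<V>_def)
      then have "\<not> 0 < r"
        using y(3) \<open>x \<in> ?P\<close> unfolding y(4) visible_def by auto
      then have "r = 0" using y(2) by simp
      then show ?thesis using y by simp
    qed
    then show ?thesis using sub_cone(1)[of F] by blast
  qed
  have cone_mono: "cone F \<subseteq> cone G" if "F \<subseteq> G" for F G
    unfolding cone_def using that by (intro hull_mono) auto
  have cone_int: "cone F \<inter> cone G = cone (F \<inter> G)" if FG: "F \<in> \<V>" "G \<in> \<V>" for F G
  proof
    show "cone F \<inter> cone G \<subseteq> cone (F \<inter> G)"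
    proof
      fix x assume x: "x \<in> cone F \<inter> cone G"
      show "x \<in> cone (F \<inter> G)"
      proof (cases "x = v")
        case True then show ?thesis using sub_cone(2) by simp
      next
        case False
        obtain y r where y: "y \<in> F" "0 \<le> r" "r < 1" "x = (1 - r) *\<^sub>R y + r *\<^sub>R v"
          using coneE[of x F] x FG False by (metis IntD1)
        obtain z s where z: "z \<in> G" "0 \<le> s" "s < 1" "x = (1 - s) *\<^sub>R z + s *\<^sub>R v"
          using coneE[of x G] x FG False by (metis IntD2)
        have "y = z"
          using visible_ray_unique[of y ?P v z r s] y z FG by (auto simp: \<V>_def)
        then have "y \<in> cone (F \<inter> G)" using y(1) z(1) sub_cone(1)[of "F \<inter> G"] by blast
        then show ?thesis
          using convexD[of "cone (F \<inter> G)" y v "1 - r" r] y sub_cone(2) by (simp add: cone_def)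
      qed
    qed
  qed (use cone_mono in blast)
  define \<T>' where "\<T>' = \<T> \<union> cone ` \<V>"
  have "simplicial_complex \<T>'"
    unfolding simplicial_complex_def
  proof (intro conjI ballI allI impI)
    show "finite \<T>'" using fin by (simp add: \<T>'_def \<V>_def)
  next
    fix S assume "S \<in> \<T>'"
    then consider "S \<in> \<T>" | F where "F \<in> \<V>" "S = cone F" by (auto simp: \<T>'_def)
    then show "\<exists>n. n simplex S"
    proof cases
      case (2 F)
      then obtain n where "n simplex F" using simp by (auto simp: \<V>_def)
      then show ?thesis using simplex_insert_dimplus1[of n F v] aff 2 by (auto simp: cone_def)
    qed (use simp in simp)
  next
    fix F S assume "S \<in> \<T>' \<and> F face_of S"
    then consider "S \<in> \<T>" "F face_of S" | G where "G \<in> \<V>" "F face_of cone G" by (auto simp: \<T>'_def)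
    then show "F \<in> \<T>'"
    proof cases
      case (2 G)
      then have "F face_of G \<or> (\<exists>F'. F' face_of G \<and> F = cone F')"
        using cone_face by simp
      then show ?thesis
        using \<V>face[OF \<open>G \<in> \<V>\<close>] by (auto simp: \<T>'_def \<V>_def)
    qed (use face in \<open>auto simp: \<T>'_def\<close>)
  next
    fix S S' assume SS': "S \<in> \<T>' \<and> S' \<in> \<T>'"
    have self: "F face_of cone F" if "F \<in> \<V>" for F
      using cone_face[OF that, of F] conv that by (auto simp: \<V>_def face_of_refl)
    show "S \<inter> S' face_of S"
    proof (cases "S \<in> \<T>")
      case True
      show ?thesis
      proof (cases "S' \<in> \<T>")
        case True then show ?thesis using \<open>S \<in> \<T>\<close> int by blast
      next
        case False
        then obtain F where "F \<in> \<V>" "S' = cone F" using SS' by (auto simp: \<T>'_def)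
        then show ?thesis using \<open>S \<in> \<T>\<close> int inT by (auto simp: \<V>_def)
      qed
    next
      case False
      then obtain F where F: "F \<in> \<V>" "S = cone F" using SS' by (auto simp: \<T>'_def)
      show ?thesis
      proof (cases "S' \<in> \<T>")
        case True
        then have "F \<inter> S' face_of F" using F int by (auto simp: \<V>_def)
        then have "F \<inter> S' face_of cone F" using cone_face[OF F(1)] by blast
        then show ?thesis using inT[OF True F(1)] F by (simp add: Int_commute)
      next
        case False
        then obtain G where G: "G \<in> \<V>" "S' = cone G" using SS' by (auto simp: \<T>'_def)
        have "F \<inter> G face_of F" using F G int by (auto simp: \<V>_def)
        then show ?thesis using cone_face[OF F(1)] cone_int F G by auto
      qed
    qed
  qed
  moreover have "\<Union>\<T>' = convex hull (insert v A)"
  proof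
    have "S \<subseteq> convex hull (insert v A)" if "S \<in> \<T>" for S
      using that cov hull_mono[of A "insert v A" convex] by blast
    moreover have "cone F \<subseteq> convex hull (insert v A)" if "F \<in> \<V>" for F
      unfolding cone_def using calculation[of F] that
      by (intro hull_minimal) (auto simp: \<V>_def hull_inc)
    ultimately show "\<Union>\<T>' \<subseteq> convex hull (insert v A)" by (auto simp: \<T>'_def)
  next
    show "convex hull (insert v A) \<subseteq> \<Union>\<T>'"
    proof
      fix x assume "x \<in> convex hull (insert v A)"
      then have "x \<in> convex hull (insert v ?P)" by (metis hull_insert)
      then obtain y r where y: "y \<in> ?P" "0 \<le> r" "r \<le> 1" "x = (1 - r) *\<^sub>R y + r *\<^sub>R v"
        using \<open>A \<noteq> {}\<close> by (elim convex_hull_insert_convex[OF convex_convex_hull]) auto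
      show "x \<in> \<Union>\<T>'"
      proof (cases "x \<in> ?P")
        case True then show ?thesis using cov by (auto simp: \<T>'_def)
      next
        case False
        have "compact ?P" using \<open>finite A\<close> by (simp add: finite_imp_compact_convex_hull)
        then obtain z s where z: "z \<in> ?V" "0 < s" "s \<le> 1" "x = (1 - s) *\<^sub>R z + s *\<^sub>R v"
          by (rule visible_last_point[OF _ convex_convex_hull y False])
        \<comment> \<open>The simplex carrying \<open>z\<close> in its relative interior is visible
          as a whole, so its cone was added and contains \<open>x\<close>.\<close>
        then obtain F where F: "F \<in> \<T>" "z \<in> rel_interior F"
          using simplicial_complex_rel_interior[OF cpx] cov visible_subset by (metis subsetD)
        then have "F \<in> \<V>"
          using rel_interior_visible_subset[OF convex_convex_hull conv _ F(2) z(1)] cov by (auto simp: \<V>_def)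
        have "z \<in> cone F" using F(2) sub_cone(1)[of F] rel_interior_subset by blast
        then have "x \<in> cone F"
          using convexD[of "cone F" z v "1 - s" s] z sub_cone(2) by (simp add: cone_def)
        then show ?thesis using \<open>F \<in> \<V>\<close> by (auto simp: \<T>'_def)
      qed
    qed
  qed
  moreover have "vertices S \<subseteq> insert v A" if S: "S \<in> \<T>'" for S
  proof (cases "S \<in> \<T>")
    case True then show ?thesis using vert by blast
  next
    case False
    then obtain F where F: "F \<in> \<V>" "S = cone F" using S by (auto simp: \<T>'_def)
    show ?thesis
    proof
      fix x assume "x \<in> vertices S"
      then have x: "x extreme_point_of cone F" using F by (simp add: vertices_def)
      then have "x \<in> insert v F" unfolding cone_def by (rule extreme_point_of_convex_hull)
      moreover have "x extreme_point_of F" if "x \<in> F"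
        using that x sub_cone(1)[of F] unfolding extreme_point_of_def by blast
      ultimately show "x \<in> insert v A"
        using vert[of F] F by (auto simp: vertices_def \<V>_def)
    qed
  qed
  ultimately show ?thesis using that[of \<T>'] by (auto simp: \<T>'_def)
qed

text \<open>Convex position puts each new point outside the hull of its predecessors, as placing
  demands. \<open>B\<close> may overlap \<open>A\<close>; points already in \<open>A\<close> are
  skipped.\<close>

corollary placing_extension_finite:
  fixes A :: "'a::euclidean_space set"
  assumes "finite B" and "convex_position (A \<union> B)" "A \<noteq> {}"
    and "simplicial_complex \<T>" "\<Union>\<T> = convex hull A" "finite A" "\<And>S. S \<in> \<T> \<Longrightarrow> vertices S \<subseteq> A"
  shows "\<exists>\<T>'. \<T> \<subseteq> \<T>' \<and> simplicial_complex \<T>' \<and> \<Union>\<T>' = convex hull (A \<union> B) \<and>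
    (\<forall>S\<in>\<T>'. vertices S \<subseteq> A \<union> B)"
  using assms
proof (induction B rule: finite_induct)
  case empty
  then show ?case by (intro exI[of _ \<T>] conjI ballI) simp_all
next
  case (insert v B)
  have sub: "x extreme_point_of convex hull C" if "x \<in> C" "C \<subseteq> A \<union> insert v B" for x C
  proof -
    have "x extreme_point_of convex hull (A \<union> insert v B)"
      using insert.prems(1) that by (auto simp: convex_position_def)
    then show ?thesis
      using hull_mono[OF that(2), of convex] hull_inc[OF that(1), of convex]
      unfolding extreme_point_of_def by blast
  qed
  have "convex_position (A \<union> B)"
    unfolding convex_position_def using sub[of _ "A \<union> B"] by blast
  then obtain \<T>' where T': "\<T> \<subseteq> \<T>'" "simplicial_complex \<T>'" "\<Union>\<T>' = convex hull (A \<union> B)"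
    "\<forall>S\<in>\<T>'. vertices S \<subseteq> A \<union> B"
    using insert.IH[OF _ insert.prems(2-)] by auto
  show ?case
  proof (cases "v \<in> A")
    case True
    then show ?thesis using T' by (intro exI[of _ \<T>']) (auto simp: insert_absorb)
  next
    case False
    have "v \<notin> convex hull (A \<union> B)"
    proof
      assume "v \<in> convex hull (A \<union> B)"
      moreover have "v extreme_point_of convex hull (insert v (A \<union> B))"
        by (intro sub) auto
      ultimately have "v extreme_point_of convex hull (A \<union> B)"
        using hull_mono[of "A \<union> B" "insert v (A \<union> B)" convex]
        unfolding extreme_point_of_def by blast
      then show False
        using extreme_point_of_convex_hull False insert.hyps by blast
    qed
    then obtain \<T>'' where "\<T>' \<subseteq> \<T>''" "simplicial_complex \<T>''"
      "\<Union>\<T>'' = convex hull (insert v (A \<union> B))" "\<And>S. S \<in> \<T>'' \<Longrightarrow> vertices S \<subseteq> insert v (A \<union> B)"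
      using placing_extension[OF T'(2,3), of v] T'(4) insert.prems insert.hyps by auto
    then show ?thesis using T'(1) by (intro exI[of _ \<T>'']) auto
  qed
qed

subsection \<open>Simplicial complexes from cells, and regularity\<close>

text \<open>Intersections of whole cells determine those of their faces: inside an affinely
  independent set, hulls of subsets intersect in the hull of the common points. This is used once
  inside \<open>V\<close> and once inside \<open>W\<close>.\<close>

lemma simplicial_complex_of_cells:
  fixes \<C> :: "'a::euclidean_space set set"
  assumes "finite \<C>" and indep: "\<And>V. V \<in> \<C> \<Longrightarrow> \<not> affine_dependent V"
    and int: "\<And>V W. V \<in> \<C> \<Longrightarrow> W \<in> \<C> \<Longrightarrow> convex hull V \<inter> convex hull W \<subseteq> convex hull (V \<inter> W)"
  defines "\<T> \<equiv> (\<lambda>F. convex hull F) ` (\<Union>V\<in>\<C>. Pow V)"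
  shows "simplicial_complex \<T>" "\<Union>\<T> = (\<Union>V\<in>\<C>. convex hull V)"
    "\<And>S. S \<in> \<T> \<Longrightarrow> vertices S \<subseteq> \<Union>\<C>"
proof -
  have indep_sub: "\<not> affine_dependent F" if "F \<subseteq> V" "V \<in> \<C>" for F V
    using that indep affine_dependent_subset by blast
  have Int: "convex hull F \<inter> convex hull G = convex hull (F \<inter> G)"
    if "V \<in> \<C>" "W \<in> \<C>" "F \<subseteq> V" "G \<subseteq> W" for F G V W
  proof
    have *: "convex hull F \<inter> convex hull (V \<inter> W) = convex hull (F \<inter> W)"
    proof -
      have "convex hull (F \<inter> (V \<inter> W)) = convex hull F \<inter> convex hull (V \<inter> W)"
        using that by (intro convex_hull_Int indep_sub[of _ V]) auto
      then show ?thesis using that by (metis Int_absorb2 Int_assoc)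
    qed
    have **: "convex hull (F \<inter> W) \<inter> convex hull G = convex hull (F \<inter> G)"
    proof -
      have "convex hull ((F \<inter> W) \<inter> G) = convex hull (F \<inter> W) \<inter> convex hull G"
        using that by (intro convex_hull_Int indep_sub[of _ W]) auto
      then show ?thesis using that by (metis Int_absorb1 Int_assoc)
    qed
    have "convex hull F \<inter> convex hull G \<subseteq> convex hull F \<inter> (convex hull V \<inter> convex hull W) \<inter> convex hull G"
      using hull_mono[OF that(3), of convex] hull_mono[OF that(4), of convex] by blast
    also have "\<dots> \<subseteq> convex hull F \<inter> convex hull (V \<inter> W) \<inter> convex hull G"
      using int[OF that(1,2)] by blast
    also have "\<dots> = convex hull (F \<inter> G)" by (simp only: * **)
    finally show "convex hull F \<inter> convex hull G \<subseteq> convex hull (F \<inter> G)" .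
    show "convex hull (F \<inter> G) \<subseteq> convex hull F \<inter> convex hull G"
      by (simp add: hull_mono)
  qed
  have fin: "finite V" if "V \<in> \<C>" for V using indep[OF that] aff_independent_finite by blast
  show "simplicial_complex \<T>"
    unfolding simplicial_complex_def
  proof (intro conjI ballI allI impI)
    show "finite \<T>" using \<open>finite \<C>\<close> fin by (auto simp: \<T>_def)
  next
    fix S assume "S \<in> \<T>"
    then obtain F V where "F \<subseteq> V" "V \<in> \<C>" "S = convex hull F" by (auto simp: \<T>_def)
    then have "(int (card F) - 1) simplex S" using indep_sub by (auto intro: simplex_convex_hull)
    then show "\<exists>n. n simplex S" ..
  next
    fix F S assume "S \<in> \<T> \<and> F face_of S"
    then obtain G V where G: "G \<subseteq> V" "V \<in> \<C>" "F face_of convex hull G" by (auto simp: \<T>_def)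
    then obtain c where "c \<subseteq> G" "F = convex hull c"
      using face_of_convex_hull_affine_independent[OF indep_sub[OF G(1,2)]] by auto
    then show "F \<in> \<T>" using G unfolding \<T>_def by blast
  next
    fix S S' assume "S \<in> \<T> \<and> S' \<in> \<T>"
    then obtain F V G W where F: "F \<subseteq> V" "V \<in> \<C>" "S = convex hull F" and G: "G \<subseteq> W" "W \<in> \<C>" "S' = convex hull G"
      by (auto simp: \<T>_def)
    then have "S \<inter> S' = convex hull (F \<inter> G)" using Int by simp
    then show "S \<inter> S' face_of S"
      using face_of_convex_hull_affine_independent[OF indep_sub[OF F(1,2)]] F(3) by auto
  qed
  show "\<Union>\<T> = (\<Union>V\<in>\<C>. convex hull V)"
  proof
    show "\<Union>\<T> \<subseteq> (\<Union>V\<in>\<C>. convex hull V)"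
    proof clarify
      fix x S assume "x \<in> S" "S \<in> \<T>"
      then obtain F V where "F \<subseteq> V" "V \<in> \<C>" "x \<in> convex hull F" by (auto simp: \<T>_def)
      then show "x \<in> (\<Union>V\<in>\<C>. convex hull V)" using hull_mono[of F V convex] by auto
    qed
    show "(\<Union>V\<in>\<C>. convex hull V) \<subseteq> \<Union>\<T>"
      unfolding \<T>_def by blast
  qed
  fix S assume "S \<in> \<T>"
  then obtain F V where "F \<subseteq> V" "V \<in> \<C>" "S = convex hull F" by (auto simp: \<T>_def)
  then show "vertices S \<subseteq> \<Union>\<C>"
    using extreme_point_of_convex_hull[of _ F] by (auto simp: vertices_def)
qed

text \<open>Allows the vertices of a cell to be recovered from its hull.\<close>

lemma convex_position_hull_mem:
  assumes "convex_position A" "V \<subseteq> A" "a \<in> A" "a \<in> convex hull V"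
  shows "a \<in> V"
proof -
  have "a extreme_point_of convex hull A" using assms(1,3) by (simp add: convex_position_def)
  then have "a extreme_point_of convex hull V"
    using assms(4) hull_mono[OF assms(2), of convex] unfolding extreme_point_of_def by blast
  then show ?thesis by (rule extreme_point_of_convex_hull)
qed

text \<open>The negative and the positive part of \<open>d\<close> give two points of the lifted polytope over the same
  point of the base; the first one lies on the lower face above \<open>V\<close>, the second one does not.\<close>

lemma lower_projection_dependency_pos:
  fixes A :: "'a::euclidean_space set" and d :: "'a \<Rightarrow> real"
  assumes fin: "finite A" and pos: "convex_position A"
    and V: "V \<subseteq> A" "convex hull V \<in> lower_projection w A"
    and d: "(\<Sum>a\<in>A. d a) = 0" "(\<Sum>a\<in>A. d a *\<^sub>R a) = 0"
    and neg: "\<And>a. a \<in> A \<Longrightarrow> d a < 0 \<Longrightarrow> a \<in> V"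
    and b: "b \<in> A" "b \<notin> V" "0 < d b"
  shows "0 < (\<Sum>a\<in>A. d a * w a)"
proof -
  define g where "g a = (a, w a)" for a
  define L where "L = lifted_polytope w A"
  have L: "L = convex hull (g ` A)"
    by (simp add: L_def lifted_polytope_def g_def)
  obtain F where F: "F face_of L" "F \<subseteq> lower_envelope L" "fst ` F = convex hull V"
    using V(2) by (auto simp: lower_projection_def L_def)
  have "polyhedron L"
    unfolding L using fin by (intro polyhedron_convex_hull) auto
  then obtain \<alpha> \<beta> where sup: "L \<subseteq> {x. \<alpha> \<bullet> x \<le> \<beta>}" and F_eq: "F = L \<inter> {x. \<alpha> \<bullet> x = \<beta>}"
    using F(1) exposed_face_of_polyhedron[of L F] by (auto simp: exposed_face_of_def)
  \<comment> \<open>The slack of a lifted point in the inequality that exposes \<open>F\<close>; it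
    vanishes on \<open>V\<close> and is positive on the rest of \<open>A\<close>.\<close>
  define h where "h a = \<beta> - \<alpha> \<bullet> g a" for a
  have gL: "g a \<in> L" if "a \<in> A" for a
    unfolding L using that by (intro hull_inc) auto
  have h_nonneg: "h a \<ge> 0" if "a \<in> A" for a
    using sup gL[OF that] by (auto simp: h_def)
  have h_V: "h a = 0" if "a \<in> V" for a
  proof -
    obtain B where B: "B \<subseteq> g ` A" "F = convex hull B"
      using F(1) fin unfolding L by (metis face_of_convex_hull_subset finite_imageI finite_imp_compact)
    obtain C where C: "C \<subseteq> A" "B = g ` C" using B(1) by (auto simp: subset_image_iff)
    have "fst ` F = convex hull (fst ` B)"
      unfolding B(2) by (rule convex_hull_linear_image) (simp add: linear_fst)
    also have "fst ` B = C" by (simp add: C(2) g_def image_image)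
    finally have "a \<in> convex hull C" using F(3) that hull_inc by metis
    then have "a \<in> C" using convex_position_hull_mem[OF pos C(1)] V(1) that by blast
    then have "g a \<in> F" unfolding B(2) C(2) by (intro hull_inc) auto
    then show ?thesis by (simp add: F_eq h_def)
  qed
  have h_pos: "h a > 0" if "a \<in> A" "a \<notin> V" for a
  proof -
    have "g a \<notin> F"
    proof
      assume "g a \<in> F"
      then have "a \<in> fst ` F" by (force simp: g_def)
      then show False using F(3) convex_position_hull_mem[OF pos V(1)] that by simp
    qed
    then show ?thesis using h_nonneg[OF that(1)] gL[OF that(1)] by (auto simp: F_eq h_def)
  qed
  \<comment> \<open>Positive and negative part have the same total \<open>s\<close>; dividing by it
    turns both into convex combinations.\<close>
  define s where "s = (\<Sum>a\<in>A. max (d a) 0)"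
  have "0 < s"
    unfolding s_def using b fin by (intro sum_pos2[of A b]) auto
  have neg_sum: "(\<Sum>a\<in>A. max (- d a) 0) = s"
  proof -
    have "(\<Sum>a\<in>A. max (d a) 0) - (\<Sum>a\<in>A. max (- d a) 0) = (\<Sum>a\<in>A. d a)"
      unfolding sum_subtractf[symmetric] by (intro sum.cong) auto
    then show ?thesis by (simp add: s_def d)
  qed
  define p where "p = (\<Sum>a\<in>A. (max (- d a) 0 / s) *\<^sub>R g a)"
  define q where "q = (\<Sum>a\<in>A. (max (d a) 0 / s) *\<^sub>R g a)"
  have pL: "p \<in> L"
    unfolding p_def using \<open>0 < s\<close> neg_sum fin gL convex_convex_hull[of "g ` A"]
    by (intro convex_sum) (auto simp: L simp flip: sum_divide_distrib)
  have qL: "q \<in> L"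
    unfolding q_def using \<open>0 < s\<close> fin gL convex_convex_hull[of "g ` A"]
    by (intro convex_sum) (auto simp: L s_def simp flip: sum_divide_distrib)
  have height: "\<beta> - \<alpha> \<bullet> (\<Sum>a\<in>A. u a *\<^sub>R g a) = (\<Sum>a\<in>A. u a * h a)" if "sum u A = 1" for u
    by (simp add: h_def inner_sum_right right_diff_distrib sum_subtractf that flip: sum_distrib_right)
  have "\<beta> - \<alpha> \<bullet> p = (\<Sum>a\<in>A. max (- d a) 0 / s * h a)"
    unfolding p_def using neg_sum \<open>0 < s\<close> by (intro height) (simp flip: sum_divide_distrib)
  also have "\<dots> = 0"
    using neg h_V by (intro sum.neutral) (auto simp: max_def)
  finally have "p \<in> F" using pL by (simp add: F_eq)
  have "\<beta> - \<alpha> \<bullet> q = (\<Sum>a\<in>A. max (d a) 0 / s * h a)"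
    unfolding q_def using \<open>0 < s\<close> by (intro height) (simp add: s_def flip: sum_divide_distrib)
  also have "\<dots> > 0"
    using b h_pos h_nonneg \<open>0 < s\<close> fin by (intro sum_pos2[of A b]) auto
  finally have "q \<notin> F" by (simp add: F_eq)
  have qp: "q - p = (\<Sum>a\<in>A. (d a / s) *\<^sub>R g a)"
    unfolding p_def q_def sum_subtractf[symmetric] scaleR_diff_left[symmetric]
    by (intro sum.cong) (auto simp: max_def diff_divide_distrib)
  have "fst (q - p) = (1 / s) *\<^sub>R (\<Sum>a\<in>A. d a *\<^sub>R a)"
    unfolding qp by (simp add: fst_sum g_def scaleR_sum_right)
  then have fst_eq: "fst q = fst p" by (simp add: d)
  have snd_eq: "snd (q - p) = (\<Sum>a\<in>A. d a * w a) / s"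
    unfolding qp by (simp add: snd_sum g_def sum_divide_distrib)
  \<comment> \<open>The lower envelope gives the weak inequality of heights;
    \<open>q \<notin> F\<close> makes it strict.\<close>
  have "p \<in> lower_envelope L" using \<open>p \<in> F\<close> F(2) by blast
  then have "\<not> snd q < snd p"
    using qL fst_eq unfolding lower_envelope_def by (cases p, cases q) auto
  moreover have "snd q \<noteq> snd p"
    using \<open>p \<in> F\<close> \<open>q \<notin> F\<close> fst_eq by (metis prod_eqI)
  ultimately have "snd (q - p) > 0" by simp
  then have "0 < (\<Sum>a\<in>A. d a * w a) / s" unfolding snd_eq .
  then show ?thesis using \<open>0 < s\<close> by (simp add: zero_less_divide_iff)
qed

subsection \<open>Vertices of the Birkhoff polytope\<close>

text \<open>Source of convexity and of the finiteness of the vertex set. Entries, row sums and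
  column sums are rewritten as inner products to exhibit half-spaces and hyperplanes.\<close>

lemma polyhedron_birkhoff_polytope: "polyhedron (birkhoff_polytope :: (real ^ 'p ^ 'p) set)"
proof -
  have entry: "M $ i $ j = axis i (axis j 1) \<bullet> M" for M :: "real ^ 'p ^ 'p" and i j
    by (simp add: inner_axis')
  have row: "(\<Sum>j\<in>UNIV. M $ i $ j) = axis i (\<chi> j. 1) \<bullet> M" for M :: "real ^ 'p ^ 'p" and i
    by (simp add: inner_axis' inner_vec_def[of "\<chi> j. 1"])
  have col: "(\<Sum>i\<in>UNIV. M $ i $ j) = (\<chi> i. axis j 1) \<bullet> M" for M :: "real ^ 'p ^ 'p" and j
    by (simp add: inner_vec_def[of "\<chi> i. axis j 1"] inner_axis')
  have "(birkhoff_polytope :: (real ^ 'p ^ 'p) set) =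
      \<Inter>(range (\<lambda>(i, j). {M. axis i (axis j 1) \<bullet> M \<ge> 0})) \<inter>
      \<Inter>(range (\<lambda>i. {M. axis i (\<chi> j. 1) \<bullet> M = 1})) \<inter>
      \<Inter>(range (\<lambda>j. {M. (\<chi> i. axis j 1) \<bullet> M = 1}))"
    unfolding birkhoff_polytope_def entry[symmetric] row[symmetric] col[symmetric] by auto
  also have "polyhedron \<dots>"
    by (intro polyhedron_Int polyhedron_Inter)
       (auto simp: polyhedron_halfspace_ge polyhedron_hyperplane)
  finally show ?thesis .
qed

lemma finite_vertices_birkhoff: "finite (vertices (birkhoff_polytope :: (real ^ 'p ^ 'p) set))"
  unfolding vertices_def by (rule finite_polyhedron_extreme_points[OF polyhedron_birkhoff_polytope])

lemma convex_position_vertices: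
  fixes P :: "'a::euclidean_space set"
  assumes "convex P"
  shows "convex_position (vertices P)"
  unfolding convex_position_def
proof
  fix v assume v: "v \<in> vertices P"
  have "convex hull (vertices P) \<subseteq> P"
    using assms by (intro hull_minimal) (auto simp: vertices_def extreme_point_of_def)
  then show "v extreme_point_of convex hull (vertices P)"
    using v hull_inc[OF v, of convex] unfolding vertices_def extreme_point_of_def by blast
qed

text \<open>All entries lie in the interval from 0 to 1, and 0 and 1 are its extreme points, so a
  segment through \<open>M\<close> is constant in every entry.\<close>

lemma binary_vertex_birkhoff:
  assumes M: "M \<in> birkhoff_polytope" and bin: "\<And>i j. M $ i $ j = 0 \<or> M $ i $ j = 1"
  shows "M \<in> vertices birkhoff_polytope"
proof -
  have le1: "N $ i $ j \<le> 1" if "N \<in> birkhoff_polytope" for N :: "real ^ 'a ^ 'a" and i j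
    using that member_le_sum[of j UNIV "\<lambda>j. N $ i $ j"] by (simp add: birkhoff_polytope_def)
  have False if N: "N \<in> birkhoff_polytope" "N' \<in> birkhoff_polytope" and "N \<noteq> N'"
    and t: "0 < t" "t < 1" and eq: "M = (1 - t) *\<^sub>R N + t *\<^sub>R N'" for N N' t
  proof -
    have "N $ i $ j = N' $ i $ j" for i j
    proof -
      have e: "M $ i $ j = (1 - t) * N $ i $ j + t * N' $ i $ j" by (simp add: eq)
      have b: "0 \<le> N $ i $ j" "0 \<le> N' $ i $ j" "N $ i $ j \<le> 1" "N' $ i $ j \<le> 1"
        using N le1 by (auto simp: birkhoff_polytope_def)
      from bin[of i j] show ?thesis
      proof
        assume "M $ i $ j = 0"
        then have "(1 - t) * N $ i $ j = 0" "t * N' $ i $ j = 0"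
          using e b t by (smt (verit) mult_nonneg_nonneg)+
        then show ?thesis using t by simp
      next
        assume "M $ i $ j = 1"
        then have "(1 - t) * (1 - N $ i $ j) + t * (1 - N' $ i $ j) = 0"
          using e by (simp add: algebra_simps)
        moreover have "0 \<le> (1 - t) * (1 - N $ i $ j)" "0 \<le> t * (1 - N' $ i $ j)"
          using b t by simp_all
        ultimately have "(1 - t) * (1 - N $ i $ j) = 0" "t * (1 - N' $ i $ j) = 0"
          by linarith+
        then show ?thesis using t by simp
      qed
    qed
    then show False using \<open>N \<noteq> N'\<close> by (simp add: vec_eq_iff)
  qed
  then show ?thesis
    using M by (auto simp: vertices_def extreme_point_of_def in_segment)
qed

subsection \<open>Eleven permutation matrices\<close>

text \<open>The labels stand for eleven permutation matrices. They satisfy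
  \<open>E\<^sub>i + A\<^sub>1 + A\<^sub>2 = N\<^sub>i + D\<^sub>j + D\<^sub>k\<close> whenever \<open>{i, j, k} = {1, 2, 3}\<close>, and these three relations
  span all linear relations between them.\<close>

datatype label = E1 | E2 | E3 | N1 | N2 | N3 | D1 | D2 | D3 | A1 | A2

lemma UNIV_label: "UNIV = {E1, E2, E3, N1, N2, N3, D1, D2, D3, A1, A2}"
  using label.exhaust by blast

instance label :: finite
  by standard (simp add: UNIV_label)

lemma all_label:
  "(\<forall>l. P l) \<longleftrightarrow> P E1 \<and> P E2 \<and> P E3 \<and> P N1 \<and> P N2 \<and> P N3 \<and> P D1 \<and> P D2 \<and> P D3 \<and> P A1 \<and> P A2"
proof -
  have "(\<forall>l. P l) \<longleftrightarrow> (\<forall>l\<in>UNIV. P l)" by simp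
  then show ?thesis unfolding UNIV_label by simp
qed

lemma ex_label:
  "(\<exists>l. P l) \<longleftrightarrow> P E1 \<or> P E2 \<or> P E3 \<or> P N1 \<or> P N2 \<or> P N3 \<or> P D1 \<or> P D2 \<or> P D3 \<or> P A1 \<or> P A2"
proof -
  have "(\<exists>l. P l) \<longleftrightarrow> (\<exists>l\<in>UNIV. P l)" by simp
  then show ?thesis unfolding UNIV_label by simp
qed

definition word :: "4 \<Rightarrow> 4 \<Rightarrow> 4 \<Rightarrow> 4 \<Rightarrow> 4 \<Rightarrow> 4" where
  "word a b c d i = (if i = 1 then a else if i = 2 then b else if i = 3 then c else d)"

text \<open>Rows and columns are numbered \<open>1, 2, 3, 4\<close>; in the index type, \<open>4 = 0\<close>.\<close>

primrec perm :: "label \<Rightarrow> 4 \<Rightarrow> 4" where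
  "perm E1 = word 2 4 3 1"
| "perm E2 = word 3 4 1 2"
| "perm E3 = word 4 1 3 2"
| "perm N1 = word 2 3 4 1"
| "perm N2 = word 3 2 1 4"
| "perm N3 = word 4 1 2 3"
| "perm D1 = word 1 3 4 2"
| "perm D2 = word 1 2 3 4"
| "perm D3 = word 1 4 2 3"
| "perm A1 = word 1 2 4 3"
| "perm A2 = word 1 3 2 4"

definition perm_matrix :: "label \<Rightarrow> real ^ 4 ^ 4" where
  "perm_matrix l = (\<chi> i j. of_bool (perm l i = j))"

text \<open>The general linear relation. As a linear form in \<open>(a, b, c)\<close>, the coefficient of \<open>l\<close> is the
  vector of the Gale dual that belongs to \<open>l\<close>.\<close>

primrec gale :: "real \<Rightarrow> real \<Rightarrow> real \<Rightarrow> label \<Rightarrow> real" where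
  "gale a b c E1 = a"
| "gale a b c E2 = b"
| "gale a b c E3 = c"
| "gale a b c N1 = - a"
| "gale a b c N2 = - b"
| "gale a b c N3 = - c"
| "gale a b c D1 = - (b + c)"
| "gale a b c D2 = - (a + c)"
| "gale a b c D3 = - (a + b)"
| "gale a b c A1 = a + b + c"
| "gale a b c A2 = a + b + c"

lemma inj_perm_matrix: "inj perm_matrix"
proof (rule injI)
  fix l m assume "perm_matrix l = perm_matrix m"
  then have "perm l i = perm m i" for i
    by (simp add: perm_matrix_def vec_eq_iff) (metis (full_types) of_bool_eq_iff)
  then have "perm l 1 = perm m 1" "perm l 2 = perm m 2" "perm l 3 = perm m 3" by blast+
  then show "l = m"
    by (cases l; cases m; simp add: word_def)
qed

lemma perm_matrix_vertex: "perm_matrix l \<in> vertices birkhoff_polytope"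
proof (rule binary_vertex_birkhoff)
  have "(\<Sum>i\<in>UNIV. of_bool (perm l i = j)) = (1::real)" for j
    using exhaust_4[of j] by (cases l) (auto simp: sum_4 word_def)
  then show "perm_matrix l \<in> birkhoff_polytope"
    by (simp add: birkhoff_polytope_def perm_matrix_def sum_of_bool_eq)
qed (simp add: perm_matrix_def)

lemma sum_label: "(\<Sum>l\<in>UNIV. f l) = f E1 + f E2 + f E3 + f N1 + f N2 + f N3 + f D1 + f D2 + f D3 + f A1 + f (A2 :: label)"
  by (simp add: UNIV_label add.assoc)

lemma sum_gale: "(\<Sum>l\<in>UNIV. gale a b c l) = 0"
  by (simp add: sum_label)

lemma sum_gale_perm_matrix: "(\<Sum>l\<in>UNIV. gale a b c l *\<^sub>R perm_matrix l) = 0"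
  by (simp add: vec_eq_iff sum_label perm_matrix_def forall_4 word_def)

text \<open>The entry equations leave exactly the coefficients of \<open>E1\<close>,
  \<open>E2\<close>, \<open>E3\<close> free. Rows of permutation matrices sum to 1, so linear
  relations are affine ones.\<close>

lemma dependency_gale:
  assumes "(\<Sum>l\<in>UNIV. d l *\<^sub>R perm_matrix l) = 0"
  shows "d = gale (d E1) (d E2) (d E3)"
proof -
  have "\<forall>i j. (\<Sum>l\<in>UNIV. d l *\<^sub>R perm_matrix l) $ i $ j = 0" using assms by simp
  then have "\<forall>l. d l = gale (d E1) (d E2) (d E3) l"
    by (simp add: sum_label perm_matrix_def forall_4 word_def all_label)
  then show ?thesis by (intro ext) (rule spec)
qed

text \<open>Weights are indexed by all labels, with zeros outside \<open>S\<close>, so that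
  representations over different cells can be subtracted and relations added.\<close>

lemma convex_hull_perm_matrix:
  "x \<in> convex hull (perm_matrix ` S) \<longleftrightarrow>
    (\<exists>u. (\<forall>l. 0 \<le> u l) \<and> (\<forall>l. l \<notin> S \<longrightarrow> u l = 0) \<and> (\<Sum>l\<in>UNIV. u l) = 1 \<and> (\<Sum>l\<in>UNIV. u l *\<^sub>R perm_matrix l) = x)"
  (is "_ \<longleftrightarrow> (\<exists>u. ?R u)")
proof
  assume "x \<in> convex hull (perm_matrix ` S)"
  then obtain f where f: "\<forall>y\<in>perm_matrix ` S. 0 \<le> f y" "sum f (perm_matrix ` S) = 1" "(\<Sum>y\<in>perm_matrix ` S. f y *\<^sub>R y) = x"
    by (auto simp: convex_hull_finite)
  have inj: "inj_on perm_matrix S" using inj_perm_matrix inj_on_subset by blast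
  let ?u = "\<lambda>l. if l \<in> S then f (perm_matrix l) else 0"
  have "(\<Sum>l\<in>UNIV. ?u l) = (\<Sum>l\<in>S. f (perm_matrix l))"
    by (simp add: sum.If_cases)
  moreover have "(\<Sum>l\<in>UNIV. ?u l *\<^sub>R perm_matrix l) = (\<Sum>l\<in>S. f (perm_matrix l) *\<^sub>R perm_matrix l)"
    by (rule sum.mono_neutral_cong_right) auto
  ultimately have "?R ?u"
    using f by (auto simp: sum.reindex[OF inj])
  then show "\<exists>u. ?R u" by (rule exI[of _ ?u])
next
  assume "\<exists>u. ?R u"
  then obtain u where u: "?R u" ..
  have "(\<Sum>l\<in>UNIV. u l) = (\<Sum>l\<in>S. u l)" "(\<Sum>l\<in>UNIV. u l *\<^sub>R perm_matrix l) = (\<Sum>l\<in>S. u l *\<^sub>R perm_matrix l)"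
    by (rule sum.mono_neutral_right; use u in auto)+
  then have "sum u S = 1" "(\<Sum>l\<in>S. u l *\<^sub>R perm_matrix l) = x" using u by auto
  moreover have "(\<Sum>l\<in>S. u l *\<^sub>R perm_matrix l) \<in> convex hull (perm_matrix ` S)"
    using u calculation by (intro convex_sum) (auto intro: hull_inc)
  ultimately show "x \<in> convex hull (perm_matrix ` S)" by simp
qed

text \<open>Complements of the maximal cells. Rotating the indices \<open>1, 2, 3\<close> is a symmetry.\<close>

definition co_cells :: "label set set" where
  "co_cells = {{N1, N2, N3}, {D1, D2, D3},
    {D1, N1, E2}, {D2, N2, E3}, {D3, N3, E1},
    {D1, D3, E2}, {D2, D1, E3}, {D3, D2, E1},
    {D2, N1, N2}, {D3, N2, N3}, {D1, N3, N1},
    {D1, D2, N1}, {D2, D3, N2}, {D3, D1, N3}}"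

text \<open>The dual vectors of the labels in \<open>K\<close> span the dual space, which is affine
  independence of the complementary points.\<close>

lemma gale_zero_on_co_cells:
  assumes "K \<in> co_cells" "\<forall>l\<in>K. gale a b c l = 0"
  shows "gale a b c l = 0"
proof -
  have "a = 0 \<and> b = 0 \<and> c = 0"
    using assms unfolding co_cells_def by auto
  then show ?thesis by (cases l) auto
qed

text \<open>In terms of the Gale dual: the open cones over \<open>K\<close> and \<open>L\<close> intersect.\<close>

lemma gale_opposite_signs:
  assumes "K \<in> co_cells" "L \<in> co_cells" "\<forall>l\<in>K. gale a b c l \<le> 0" "\<forall>l\<in>L. 0 \<le> gale a b c l"
  shows "\<forall>l\<in>K \<union> L. gale a b c l = 0"
proof -
  have "\<forall>K\<in>co_cells. \<forall>L\<in>co_cells. (\<forall>l\<in>K. gale a b c l \<le> 0) \<longrightarrow> (\<forall>l\<in>L. 0 \<le> gale a b c l) \<longrightarrow>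
      (\<forall>l\<in>K \<union> L. gale a b c l = 0)"
    unfolding co_cells_def ball_simps by (intro conjI; simp; linarith?)
  then show ?thesis using assms by blast
qed

text \<open>\<open>covered K\<close> says that the hull of the points outside \<open>K\<close> is covered by the cells, expressed through
  barycentric weights. It is derived by moving the weights along a relation that is zero on \<open>K\<close> until a
  further weight vanishes, which enlarges \<open>K\<close>.\<close>

definition covered :: "label set \<Rightarrow> bool" where
  "covered K \<longleftrightarrow> (\<forall>u. (\<forall>l. 0 \<le> u l) \<and> (\<forall>l\<in>K. u l = 0) \<longrightarrow>
    (\<exists>a b c. (\<forall>l. 0 \<le> u l + gale a b c l) \<and> (\<exists>L\<in>co_cells. \<forall>l\<in>L. u l + gale a b c l = 0)))"

lemma covered_mono: "covered K \<Longrightarrow> K \<subseteq> L \<Longrightarrow> covered L"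
  unfolding covered_def by blast

lemma covered_co_cells: "L \<in> co_cells \<Longrightarrow> covered L"
  unfolding covered_def
proof (intro allI impI)
  fix u :: "label \<Rightarrow> real"
  assume "L \<in> co_cells" and *: "(\<forall>l. 0 \<le> u l) \<and> (\<forall>l\<in>L. u l = 0)"
  have z: "gale 0 0 0 l = 0" for l by (cases l) auto
  show "\<exists>a b c. (\<forall>l. 0 \<le> u l + gale a b c l) \<and> (\<exists>L\<in>co_cells. \<forall>l\<in>L. u l + gale a b c l = 0)"
    by (rule exI[of _ 0], rule exI[of _ 0], rule exI[of _ 0]) (use * \<open>L \<in> co_cells\<close> in \<open>auto simp: z\<close>)
qed

lemma gale_add: "gale a b c l + gale a' b' c' l = gale (a + a') (b + b') (c + c') l"
  by (cases l) auto

lemma gale_scale: "t * gale a b c l = gale (t * a) (t * b) (t * c) l"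
  by (cases l) (auto simp: algebra_simps)

lemma covered_step:
  assumes zero: "\<forall>l\<in>K. gale a b c l = 0" and neg: "\<exists>l. gale a b c l < 0"
    and step: "\<forall>l. gale a b c l < 0 \<longrightarrow> covered (insert l K)"
  shows "covered K"
  unfolding covered_def
proof (intro allI impI)
  fix u :: "label \<Rightarrow> real"
  assume u: "(\<forall>l. 0 \<le> u l) \<and> (\<forall>l\<in>K. u l = 0)"
  define N where "N = {l. gale a b c l < 0}"
  define r where "r l = u l / (- gale a b c l)" for l
  have N: "finite N" "N \<noteq> {}" using neg by (auto simp: N_def)
  \<comment> \<open>The ratio test of the simplex method: the longest step that keeps all weights
    nonnegative. The minimizing label \<open>m\<close> reaches weight zero and joins
    \<open>K\<close>.\<close>
  define t where "t = Min (r ` N)"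
  have "t \<in> r ` N" unfolding t_def using N by (intro Min_in) auto
  then obtain m where m: "m \<in> N" "t = r m" by auto
  have "r l \<ge> 0" if "l \<in> N" for l
    using that u unfolding r_def N_def by (intro divide_nonneg_pos) auto
  then have "t \<ge> 0" using m by simp
  define \<mu> where "\<mu> l = u l + t * gale a b c l" for l
  have \<mu>: "0 \<le> \<mu> l" for l
  proof (cases "l \<in> N")
    case True
    then have "t \<le> r l" using N by (simp add: t_def)
    then show ?thesis
      using True pos_le_divide_eq[of "- gale a b c l" t "u l"] by (simp add: r_def N_def \<mu>_def del: minus_divide_right divide_minus_right)
  next
    case False
    then show ?thesis using u \<open>t \<ge> 0\<close> by (simp add: N_def \<mu>_def)
  qed
  have "\<mu> m = 0" using m by (simp add: \<mu>_def r_def N_def)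
  then have zero': "\<forall>l\<in>insert m K. \<mu> l = 0"
    using u zero by (auto simp: \<mu>_def)
  have cov: "covered (insert m K)" using step m(1) by (simp add: N_def)
  obtain a' b' c' L where *: "\<forall>l. 0 \<le> \<mu> l + gale a' b' c' l" "L \<in> co_cells" "\<forall>l\<in>L. \<mu> l + gale a' b' c' l = 0"
    using cov[unfolded covered_def, rule_format, of \<mu>] \<mu> zero' by auto
  have "u l + gale (t * a + a') (t * b + b') (t * c + c') l = \<mu> l + gale a' b' c' l" for l
    using gale_add[of "t * a" "t * b" "t * c" l a' b' c'] gale_scale[of t a b c l] by (simp add: \<mu>_def)
  with * show "\<exists>a b c. (\<forall>l. 0 \<le> u l + gale a b c l) \<and> (\<exists>L\<in>co_cells. \<forall>l\<in>L. u l + gale a b c l = 0)"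
    by (rule_tac x = "t * a + a'" in exI, rule_tac x = "t * b + b'" in exI, rule_tac x = "t * c + c'" in exI) auto
qed

lemma covered_if: "(\<exists>L\<in>co_cells. L \<subseteq> K) \<Longrightarrow> covered K"
  using covered_co_cells covered_mono by blast

text \<open>The relations vanishing on such a pair form a line. Its direction is chosen so that each
  label with negative coefficient completes the pair to a co-cell; the opposite direction would
  not.\<close>

lemma covered_ND: "{N1, D1} \<subseteq> K \<or> {N2, D2} \<subseteq> K \<or> {N3, D3} \<subseteq> K \<Longrightarrow> covered K"
proof -
  have "covered {N1, D1}"
    by (rule covered_step[of _ 0 "-1" 1]) (simp_all add: all_label ex_label covered_if co_cells_def)
  moreover have "covered {N2, D2}"
    by (rule covered_step[of _ 1 0 "-1"]) (simp_all add: all_label ex_label covered_if co_cells_def)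
  moreover have "covered {N3, D3}"
    by (rule covered_step[of _ "-1" 1 0]) (simp_all add: all_label ex_label covered_if co_cells_def)
  ultimately show "{N1, D1} \<subseteq> K \<or> {N2, D2} \<subseteq> K \<or> {N3, D3} \<subseteq> K \<Longrightarrow> covered K"
    using covered_mono by blast
qed

lemma covered_DD: "{D1, D2} \<subseteq> K \<or> {D2, D3} \<subseteq> K \<or> {D3, D1} \<subseteq> K \<Longrightarrow> covered K"
proof -
  have "covered {D1, D2}"
    by (rule covered_step[of _ 1 1 "-1"]) (simp_all add: all_label ex_label covered_if covered_ND co_cells_def)
  moreover have "covered {D2, D3}"
    by (rule covered_step[of _ "-1" 1 1]) (simp_all add: all_label ex_label covered_if covered_ND co_cells_def)
  moreover have "covered {D3, D1}"
    by (rule covered_step[of _ 1 "-1" 1]) (simp_all add: all_label ex_label covered_if covered_ND co_cells_def)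
  ultimately show "{D1, D2} \<subseteq> K \<or> {D2, D3} \<subseteq> K \<or> {D3, D1} \<subseteq> K \<Longrightarrow> covered K"
    using covered_mono by blast
qed

text \<open>A branching on the basic relations \<open>E\<^sub>i + A\<^sub>1 + A\<^sub>2 = N\<^sub>i
  + D\<^sub>j + D\<^sub>k\<close>: each step has the three branches \<open>N\<^sub>i\<close>,
  \<open>D\<^sub>j\<close>, \<open>D\<^sub>k\<close>, and the relation is picked to vanish on the
  labels collected so far.\<close>

lemma covered_empty: "covered {}"
proof -
  have D1: "covered {D1}"
    by (rule covered_step[of _ 1 0 0]) (simp_all add: all_label ex_label covered_ND covered_DD)
  have D2: "covered {D2}"
    by (rule covered_step[of _ 0 1 0]) (simp_all add: all_label ex_label covered_ND covered_DD)
  have N2N3: "covered {N2, N3}"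
    by (rule covered_step[of _ 1 0 0]) (simp_all add: all_label ex_label covered_if covered_ND co_cells_def)
  have N3D1: "covered {N3, D1}"
    by (rule covered_step[of _ 1 0 0]) (simp_all add: all_label ex_label covered_if covered_DD co_cells_def)
  have N3: "covered {N3}"
    by (rule covered_step[of _ 0 1 0]) (use N2N3 N3D1 in \<open>simp_all add: all_label ex_label covered_ND insert_commute\<close>)
  show ?thesis
    by (rule covered_step[of _ 0 0 1]) (use N3 D1 D2 in \<open>simp_all add: all_label ex_label\<close>)
qed

section \<open>The cells triangulate the hull of the eleven matrices\<close>

lemma convex_hull_eq_Union_cells:
  "convex hull (range perm_matrix) = (\<Union>K\<in>co_cells. convex hull (perm_matrix ` (- K)))"
proof
  show "convex hull (range perm_matrix) \<subseteq> (\<Union>K\<in>co_cells. convex hull (perm_matrix ` (- K)))"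
  proof
    fix x assume "x \<in> convex hull (range perm_matrix)"
    then obtain u where u: "\<forall>l. 0 \<le> u l" "sum u UNIV = 1" "(\<Sum>l\<in>UNIV. u l *\<^sub>R perm_matrix l) = x"
      unfolding convex_hull_perm_matrix by metis
    obtain a b c K where K: "\<forall>l. 0 \<le> u l + gale a b c l" "K \<in> co_cells" "\<forall>l\<in>K. u l + gale a b c l = 0"
      using covered_empty[unfolded covered_def, rule_format, of u] u(1) by auto
    \<comment> \<open>Adding a relation changes neither the total weight nor the point.\<close>
    have "(\<Sum>l\<in>UNIV. u l + gale a b c l) = 1"
      using u(2) by (simp add: sum.distrib sum_gale)
    moreover have "(\<Sum>l\<in>UNIV. (u l + gale a b c l) *\<^sub>R perm_matrix l) = x"
      using u(3) by (simp add: scaleR_left_distrib sum.distrib sum_gale_perm_matrix)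
    ultimately have "x \<in> convex hull (perm_matrix ` (- K))"
      unfolding convex_hull_perm_matrix using K by (intro exI[of _ "\<lambda>l. u l + gale a b c l"]) auto
    then show "x \<in> (\<Union>K\<in>co_cells. convex hull (perm_matrix ` (- K)))" using K(2) by blast
  qed
  show "(\<Union>K\<in>co_cells. convex hull (perm_matrix ` (- K))) \<subseteq> convex hull (range perm_matrix)"
    by (intro UN_least hull_mono) auto
qed

lemma independent_cell:
  assumes "K \<in> co_cells"
  shows "\<not> affine_dependent (perm_matrix ` (- K))"
proof
  assume "affine_dependent (perm_matrix ` (- K))"
  then obtain U where U: "(\<exists>v\<in>perm_matrix ` (- K). U v \<noteq> 0)" "(\<Sum>v\<in>perm_matrix ` (- K). U v *\<^sub>R v) = 0"
    by (auto simp: affine_dependent_explicit_finite)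
  define d where "d l = (if l \<in> K then 0 else U (perm_matrix l))" for l
  have inj: "inj_on perm_matrix (- K)" using inj_perm_matrix inj_on_subset by blast
  have "(\<Sum>l\<in>UNIV. d l *\<^sub>R perm_matrix l) = (\<Sum>l\<in>-K. U (perm_matrix l) *\<^sub>R perm_matrix l)"
    by (rule sum.mono_neutral_cong_right) (auto simp: d_def)
  also have "\<dots> = 0" using U(2) by (simp add: sum.reindex[OF inj])
  finally have d: "d = gale (d E1) (d E2) (d E3)" by (rule dependency_gale)
  have "\<forall>l\<in>K. gale (d E1) (d E2) (d E3) l = 0"
    using d by (metis d_def)
  then have d0: "d l = 0" for l
    using gale_zero_on_co_cells[OF assms] d by metis
  have "U (perm_matrix l) = 0" if "l \<notin> K" for l
    using d0[of l] that by (simp add: d_def)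
  then show False using U(1) by auto
qed

text \<open>The difference of two representations of a common point is a relation, nonpositive on
  \<open>K\<close> and nonnegative on \<open>L\<close>. It therefore vanishes on both, and the
  weights \<open>u\<close> live on the common vertices.\<close>

lemma Int_cells:
  assumes "K \<in> co_cells" "L \<in> co_cells"
  shows "convex hull (perm_matrix ` (- K)) \<inter> convex hull (perm_matrix ` (- L)) \<subseteq> convex hull (perm_matrix ` (- K) \<inter> perm_matrix ` (- L))"
proof
  fix x assume "x \<in> convex hull (perm_matrix ` (- K)) \<inter> convex hull (perm_matrix ` (- L))"
  then obtain u v where u: "\<forall>l. 0 \<le> u l" "\<forall>l\<in>K. u l = 0" "sum u UNIV = 1" "(\<Sum>l\<in>UNIV. u l *\<^sub>R perm_matrix l) = x"
    and v: "\<forall>l. 0 \<le> v l" "\<forall>l\<in>L. v l = 0" "(\<Sum>l\<in>UNIV. v l *\<^sub>R perm_matrix l) = x"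
    by (auto simp: convex_hull_perm_matrix)
  define d where "d l = u l - v l" for l
  have "(\<Sum>l\<in>UNIV. d l *\<^sub>R perm_matrix l) = 0"
    using u v by (simp add: d_def scaleR_left_diff_distrib sum_subtractf)
  then have d: "d = gale (d E1) (d E2) (d E3)" by (rule dependency_gale)
  have "\<forall>l\<in>K. d l \<le> 0" "\<forall>l\<in>L. 0 \<le> d l" using u v by (auto simp: d_def)
  then have "\<forall>l\<in>K \<union> L. d l = 0"
    using gale_opposite_signs[OF assms, of "d E1" "d E2" "d E3"] unfolding d[symmetric] by blast
  then have "\<forall>l\<in>K \<union> L. u l = 0" using u(2) v(2) by (auto simp: d_def)
  then have "x \<in> convex hull (perm_matrix ` (- (K \<union> L)))"
    unfolding convex_hull_perm_matrix using u by blast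
  moreover have "perm_matrix ` (- (K \<union> L)) \<subseteq> perm_matrix ` (- K) \<inter> perm_matrix ` (- L)" by auto
  ultimately show "x \<in> convex hull (perm_matrix ` (- K) \<inter> perm_matrix ` (- L))"
    using hull_mono by blast
qed

section \<open>The obstruction to a lifting function\<close>

lemma sum_supported_perm_matrix:
  fixes f :: "real ^ 4 ^ 4 \<Rightarrow> 'b::comm_monoid_add"
  assumes "finite A" "range perm_matrix \<subseteq> A" "\<And>a. a \<in> A \<Longrightarrow> a \<notin> range perm_matrix \<Longrightarrow> f a = 0"
  shows "sum f A = (\<Sum>l\<in>UNIV. f (perm_matrix l))"
proof -
  have "sum f A = sum f (range perm_matrix)"
    using assms by (intro sum.mono_neutral_right) auto
  then show ?thesis by (simp add: sum.reindex[OF inj_perm_matrix])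
qed

text \<open>The relation is extended by zero to the other points of \<open>A\<close>. The sign
  condition on \<open>K\<close> places its negative part in the cell; a positive label in
  \<open>K\<close> lies off the cell and gives strictness.\<close>

lemma regular_circuit:
  fixes w :: "real ^ 4 ^ 4 \<Rightarrow> real"
  assumes A: "finite A" "convex_position A" "range perm_matrix \<subseteq> A"
    and K: "convex hull (perm_matrix ` (- K)) \<in> lower_projection w A"
    and nonneg: "\<forall>l\<in>K. 0 \<le> gale a b c l" and pos: "\<exists>l\<in>K. 0 < gale a b c l"
  shows "0 < (\<Sum>l\<in>UNIV. gale a b c l * w (perm_matrix l))"
proof -
  define d where "d x = (if x \<in> range perm_matrix then gale a b c (inv perm_matrix x) else 0)" for x
  have d_perm_matrix: "d (perm_matrix l) = gale a b c l" for l
    by (simp add: d_def inv_f_f[OF inj_perm_matrix])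
  have d_zero: "d x = 0" if "x \<notin> range perm_matrix" for x using that by (simp add: d_def)
  obtain k where k: "k \<in> K" "0 < gale a b c k" using pos by blast
  have "0 < (\<Sum>x\<in>A. d x * w x)"
  proof (rule lower_projection_dependency_pos[OF A(1,2) _ K])
    show "perm_matrix ` (- K) \<subseteq> A" using A(3) by blast
    show "(\<Sum>x\<in>A. d x) = 0"
      using sum_supported_perm_matrix[OF A(1,3), of d] d_zero by (simp add: d_perm_matrix sum_gale)
    show "(\<Sum>x\<in>A. d x *\<^sub>R x) = 0"
      using sum_supported_perm_matrix[OF A(1,3), of "\<lambda>x. d x *\<^sub>R x"] d_zero by (simp add: d_perm_matrix sum_gale_perm_matrix)
    show "x \<in> perm_matrix ` (- K)" if neg: "d x < 0" for x
    proof -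
      have "x \<in> range perm_matrix" using neg d_zero[of x] by auto
      then obtain l where l: "x = perm_matrix l" by blast
      then have "l \<notin> K" using neg nonneg by (auto simp: d_perm_matrix not_less)
      then show ?thesis using l by simp
    qed
    show "perm_matrix k \<in> A" using A(3) by blast
    show "perm_matrix k \<notin> perm_matrix ` (- K)" using k inj_perm_matrix by (auto dest: injD)
    show "0 < d (perm_matrix k)" using k by (simp add: d_perm_matrix)
  qed
  also have "(\<Sum>x\<in>A. d x * w x) = (\<Sum>l\<in>UNIV. gale a b c l * w (perm_matrix l))"
    using sum_supported_perm_matrix[OF A(1,3), of "\<lambda>x. d x * w x"] d_zero by (simp add: d_perm_matrix)
  finally show ?thesis .
qed

theorem theorem3p14:
  shows "\<exists>\<T>. triangulation_of (vertices (birkhoff_polytope :: (real ^ 4 ^ 4) set)) \<T> \<and>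
             \<not> regular_triangulation_of (vertices (birkhoff_polytope :: (real ^ 4 ^ 4) set)) \<T>"
proof -
  let ?A = "vertices (birkhoff_polytope :: (real ^ 4 ^ 4) set)"
  define \<C> where "\<C> = (\<lambda>K. perm_matrix ` (- K)) ` co_cells"
  define \<T> where "\<T> = (\<lambda>F. convex hull F) ` (\<Union>V\<in>\<C>. Pow V)"
  have fin: "finite ?A" by (rule finite_vertices_birkhoff)
  have pos: "convex_position ?A"
    by (intro convex_position_vertices polyhedron_imp_convex polyhedron_birkhoff_polytope)
  have range: "range perm_matrix \<subseteq> ?A" using perm_matrix_vertex by blast
  have C: "finite \<C>" "\<And>V. V \<in> \<C> \<Longrightarrow> \<not> affine_dependent V"
    "\<And>V W. V \<in> \<C> \<Longrightarrow> W \<in> \<C> \<Longrightarrow> convex hull V \<inter> convex hull W \<subseteq> convex hull (V \<inter> W)"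
    unfolding \<C>_def using independent_cell Int_cells by auto
  have complex: "simplicial_complex \<T>" "\<Union>\<T> = (\<Union>V\<in>\<C>. convex hull V)"
    "\<And>S. S \<in> \<T> \<Longrightarrow> vertices S \<subseteq> \<Union>\<C>"
    unfolding \<T>_def by (rule simplicial_complex_of_cells; use C in blast)+
  have "\<Union>\<T> = convex hull (range perm_matrix)"
    using complex(2) convex_hull_eq_Union_cells by (simp add: \<C>_def)
  moreover have "vertices S \<subseteq> range perm_matrix" if "S \<in> \<T>" for S
    using complex(3)[OF that] by (auto simp: \<C>_def)
  moreover have un: "range perm_matrix \<union> ?A = ?A" using range by blast
  ultimately obtain \<T>' where T': "\<T> \<subseteq> \<T>'" "simplicial_complex \<T>'" "\<Union>\<T>' = convex hull ?A"
      "\<forall>S\<in>\<T>'. vertices S \<subseteq> ?A"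
    using placing_extension_finite[of ?A "range perm_matrix" \<T>] fin pos complex(1) unfolding un by auto
  have "\<not> regular_triangulation_of ?A \<T>'"
  proof
    assume "regular_triangulation_of ?A \<T>'"
    then obtain w where w: "\<T>' = lower_projection w ?A"
      by (auto simp: regular_triangulation_of_def)
    have cell: "convex hull (perm_matrix ` (- K)) \<in> lower_projection w ?A" if "K \<in> co_cells" for K
      using that T'(1) unfolding w[symmetric] \<T>_def \<C>_def by blast
    \<comment> \<open>The three relations are \<open>E\<^sub>i + D\<^sub>i + N\<^sub>j = E\<^sub>j + D\<^sub>j + N\<^sub>i\<close> for cyclically adjacent \<open>i, j\<close>; they add up to zero.\<close>
    note circuit = regular_circuit[OF fin pos range cell]
    \<comment> \<open>This relation is zero on \<open>D3\<close> and \<open>N3\<close> and positive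
      on \<open>E1\<close>; its negative labels \<open>E2\<close>, \<open>D2\<close>,
      \<open>N1\<close> span a face of the chosen cell. The other two arise by rotating the
      indices.\<close>
    have "0 < (\<Sum>l\<in>UNIV. gale 1 (-1) 0 l * w (perm_matrix l))"
      by (rule circuit[of "{D3, N3, E1}"]) (simp_all add: co_cells_def)
    moreover have "0 < (\<Sum>l\<in>UNIV. gale 0 1 (-1) l * w (perm_matrix l))"
      by (rule circuit[of "{D1, N1, E2}"]) (simp_all add: co_cells_def)
    moreover have "0 < (\<Sum>l\<in>UNIV. gale (-1) 0 1 l * w (perm_matrix l))"
      by (rule circuit[of "{D2, N2, E3}"]) (simp_all add: co_cells_def)
    ultimately show False by (simp add: sum_label)
  qed
  moreover have "triangulation_of ?A \<T>'"
    using T' fin pos by (simp add: triangulation_of_def)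
  ultimately show ?thesis by blast
qed

end
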